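(* Let $\mu$ be a probability measure on $\Omega=[0,1]^{\mathbb Z\times\mathbb N}$ which is stationary ergodic with respect to the $\mathbb Z$-shift $\theta$ and elliptic. Then $\mathbb P_0(A^+)\in\{0,1\}$ (and likewise $\mathbb P_0(A^-)\in\{0,1\}$).
   Context: Notation: $\mathbb N=\{1,2,\dots\}$. A cookie environment is $\omega\in\Omega=[0,1]^{\mathbb Z\times\mathbb N}$ (with the product Borel $\sigma$-algebra); $\omega(x,n)$ is the $n$-th cookie at site $x$. The shift $\theta$ acts by $(\theta\omega)(x,n)=\omega(x+1,n)$. A probability measure $\mu$ on $\Omega$ is stationary ergodic if it is $\theta$-invariant and ergodic for $\theta$, and elliptic if $\mu((0,1)^{\mathbb Z\times\mathbb N})=1$. For $\omega\in\Omega$ and $x\in\mathbb Z$, the excited random walk under $P_{\omega,x}$ is the process $(X_n)_{n\ge0}$ with $X_0=x$ and, conditionally on $X_0,\dots,X_{n-1}$, $X_n=X_{n-1}+1$ with probability $\omega(X_{n-1},\#\{k\le n-1:X_k=X_{n-1}\})$ and $X_n=X_{n-1}-1$ otherwise. The annealed law is $\mathbb P_x(\cdot)=\int_\Omega P_{\omega,x}(\cdot)\,d\mu(\omega)$. $A^+=\{\lim_{n\to\infty}X_n=+\infty\}$ (transience to the right), $A^-=\{\lim_{n\to\infty}X_n=-\infty\}$. *)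

theory Defs
  imports "HOL-Probability.Probability"
begin

definition cookie_index :: "(int \<times> nat) set" where
  "cookie_index = {(x, n). n \<ge> 1}"

definition Omega :: "((int \<times> nat) \<Rightarrow> real) measure" where
  "Omega = (\<Pi>\<^sub>M i\<in>cookie_index. restrict_space borel {0..1::real})"

definition shift :: "((int \<times> nat) \<Rightarrow> real) \<Rightarrow> ((int \<times> nat) \<Rightarrow> real)" where
  "shift \<omega> = (\<lambda>(x, n). \<omega> (x + 1, n))"

definition stationary :: "((int \<times> nat) \<Rightarrow> real) measure \<Rightarrow> bool" where
  "stationary \<mu> \<longleftrightarrow>
     (\<forall>A\<in>sets Omega. emeasure \<mu> (shift -` A \<inter> space Omega) = emeasure \<mu> A)"

definition ergodic :: "((int \<times> nat) \<Rightarrow> real) measure \<Rightarrow> bool" where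
  "ergodic \<mu> \<longleftrightarrow>
     (\<forall>A\<in>sets Omega. shift -` A \<inter> space Omega = A \<longrightarrow>
        measure \<mu> A = 0 \<or> measure \<mu> A = 1)"

definition elliptic :: "((int \<times> nat) \<Rightarrow> real) measure \<Rightarrow> bool" where
  "elliptic \<mu> \<longleftrightarrow>
     measure \<mu> {\<omega>\<in>space Omega. \<forall>i\<in>cookie_index. 0 < \<omega> i \<and> \<omega> i < 1} = 1"

definition Unif :: "(nat \<Rightarrow> real) measure" where
  "Unif = (\<Pi>\<^sub>M n\<in>(UNIV::nat set). uniform_measure lborel {0..1::real})"

text \<open>The history (X_0, ..., X_n) of the excited random walk in environment \<omega>
  started at x, driven by u: at step n+1 the walk sits at y = X_n, which it has
  visited c = #{k \<le> n. X_k = y} times; it jumps to y+1 iff u (n+1) < \<omega>(y,c),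
  i.e. with probability \<omega>(y,c), and to y-1 otherwise.\<close>

fun erw_hist :: "((int \<times> nat) \<Rightarrow> real) \<Rightarrow> int \<Rightarrow> (nat \<Rightarrow> real) \<Rightarrow> nat \<Rightarrow> int list" where
  "erw_hist \<omega> x u 0 = [x]"
| "erw_hist \<omega> x u (Suc n) =
     (let xs = erw_hist \<omega> x u n; y = last xs; c = count_list xs y
      in xs @ [if u (Suc n) < \<omega> (y, c) then y + 1 else y - 1])"

definition erw :: "((int \<times> nat) \<Rightarrow> real) \<Rightarrow> int \<Rightarrow> (nat \<Rightarrow> real) \<Rightarrow> nat \<Rightarrow> int" where
  "erw \<omega> x u n = last (erw_hist \<omega> x u n)"

definition quenched_right :: "((int \<times> nat) \<Rightarrow> real) \<Rightarrow> int \<Rightarrow> real" where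
  "quenched_right \<omega> x =
     measure Unif {u\<in>space Unif. filterlim (\<lambda>n. erw \<omega> x u n) at_top sequentially}"

definition quenched_left :: "((int \<times> nat) \<Rightarrow> real) \<Rightarrow> int \<Rightarrow> real" where
  "quenched_left \<omega> x =
     measure Unif {u\<in>space Unif. filterlim (\<lambda>n. erw \<omega> x u n) at_bot sequentially}"

definition annealed_right :: "((int \<times> nat) \<Rightarrow> real) measure \<Rightarrow> int \<Rightarrow> real" where
  "annealed_right \<mu> x = (\<integral>\<omega>. quenched_right \<omega> x \<partial>\<mu>)"

definition annealed_left :: "((int \<times> nat) \<Rightarrow> real) measure \<Rightarrow> int \<Rightarrow> real" where
  "annealed_left \<mu> x = (\<integral>\<omega>. quenched_left \<omega> x \<partial>\<mu>)"

end

theory Submission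
  imports Defs
begin

text \<open>Give every site a stack of right/left arrows and let the walk follow at its \<open>n\<close>-th visit to
  a site the \<open>n\<close>-th arrow there. Call a site \<open>x\<close> good if the walk started at \<open>x\<close> with fresh
  stacks stays in \<open>[x, \<infinity>)\<close> and is transient to the right. Two deterministic facts carry the proof.
  If \<open>x\<close> is good, then the walk started at \<^emph>\<open>any\<close> \<open>y \<ge> x\<close> is transient to the right: by a least
  action argument it never uses more arrows at a site than the walk from \<open>x\<close> does. If the walk from
  \<open>x\<close> is transient to the right, then \<open>x\<close> becomes good once finitely many arrows at \<open>x\<close> are turned
  to the right.

  Hence, by ellipticity, transience with positive probability makes a site good with positive
  probability. Goodness of \<open>x\<close> depends only on the arrows at sites \<open>\<ge> x\<close>, so that infinitely many
  \<open>x > 0\<close> are good is a quenched tail event; it is shift invariant, so by Kolmogorov's law and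
  ergodicity it has probability 1. Thus with high probability there is a good site in
  \<open>[0, n]\<close>, which makes the walk from \<open>n\<close>, and by stationarity the walk from 0, transient. The left
  direction follows by reflecting the environment.\<close>

section \<open>Arrow environments and good sites\<close>

type_synonym arrows = "int \<Rightarrow> nat \<Rightarrow> bool"

definition up_count :: "arrows \<Rightarrow> int \<Rightarrow> nat \<Rightarrow> nat" where
  "up_count a z m = card {c \<in> {1..m}. a z c}"

definition down_count :: "arrows \<Rightarrow> int \<Rightarrow> nat \<Rightarrow> nat" where
  "down_count a z m = card {c \<in> {1..m}. \<not> a z c}"

definition visits :: "(nat \<Rightarrow> int) \<Rightarrow> nat \<Rightarrow> int \<Rightarrow> nat" where
  "visits X n z = card {k. k < n \<and> X k = z}"

text \<open>\<open>visits\<close> counts strictly earlier times, so the first arrow used at a site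
  has number 1, matching the numbering of the cookies.\<close>

definition is_walk :: "arrows \<Rightarrow> (nat \<Rightarrow> int) \<Rightarrow> bool" where
  "is_walk a X \<longleftrightarrow>
     (\<forall>n. X (Suc n) = X n + (if a (X n) (Suc (visits X n (X n))) then 1 else - 1))"

text \<open>The inequality is the flux balance across the edge from \<open>z\<close> to \<open>z + 1\<close> when \<open>u\<close> counts
  the visits of a transient walk, so \<open>good\<close> below has the meaning given above, see
  \<open>good_iff_walk\<close>; unlike a statement about walks, a certificate is monotone in the arrows.\<close>

definition certificate :: "arrows \<Rightarrow> int \<Rightarrow> (int \<Rightarrow> nat) \<Rightarrow> bool" where
  "certificate a x u \<longleftrightarrow> down_count a x (u x) = 0 \<and>
     (\<forall>z\<ge>x. down_count a (z + 1) (u (z + 1)) < up_count a z (u z))"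

definition good :: "arrows \<Rightarrow> int \<Rightarrow> bool" where
  "good a x \<longleftrightarrow> (\<exists>u. certificate a x u)"

section \<open>Counting used arrows, and the flux across an edge\<close>

lemma up_count_0 [simp]: "up_count a z 0 = 0" and down_count_0 [simp]: "down_count a z 0 = 0"
  by (auto simp: up_count_def down_count_def)

lemma up_count_Suc: "up_count a z (Suc m) = up_count a z m + of_bool (a z (Suc m))"
proof -
  have "{c \<in> {1..Suc m}. a z c} =
      (if a z (Suc m) then insert (Suc m) {c \<in> {1..m}. a z c} else {c \<in> {1..m}. a z c})"
    by (auto simp: le_Suc_eq)
  then show ?thesis by (auto simp: up_count_def)
qed

lemma down_count_Suc: "down_count a z (Suc m) = down_count a z m + of_bool (\<not> a z (Suc m))"
  using up_count_Suc[of "\<lambda>z c. \<not> a z c" z m] by (simp add: down_count_def up_count_def)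

lemma down_count_mono: "m \<le> n \<Longrightarrow> down_count a z m \<le> down_count a z n"
  unfolding down_count_def by (intro card_mono) auto

lemma visits_0 [simp]: "visits X 0 z = 0"
  by (simp add: visits_def)

lemma visits_Suc: "visits X (Suc n) z = visits X n z + of_bool (X n = z)"
proof -
  have "{k. k < Suc n \<and> X k = z} =
      (if X n = z then insert n {k. k < n \<and> X k = z} else {k. k < n \<and> X k = z})"
    by (auto simp: less_Suc_eq)
  then show ?thesis by (auto simp: visits_def)
qed

text \<open>Each crossing of the edge between \<open>z\<close> and \<open>z + 1\<close> uses a right
  arrow at \<open>z\<close> or a left arrow at \<open>z + 1\<close>, and the two directions
  alternate. The difference therefore records only the sides on which the walk starts and currently
  stands.\<close>

lemma walk_flux:
  assumes "is_walk a X"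
  shows "int (up_count a z (visits X n z)) - int (down_count a (z + 1) (visits X n (z + 1)))
           = of_bool (X n > z) - of_bool (X 0 > z)"
proof (induction n)
  case (Suc n)
  have step: "X (Suc n) = X n + (if a (X n) (Suc (visits X n (X n))) then 1 else - 1)"
    using assms by (auto simp: is_walk_def)
  consider "X n = z" | "X n = z + 1" | "X n < z" | "X n > z + 1" by linarith
  then show ?case
    using Suc step by cases (auto simp: visits_Suc up_count_Suc down_count_Suc)
qed simp

section \<open>Good sites force transience\<close>

lemma filterlim_at_top_if_finite_visits:
  fixes X :: "nat \<Rightarrow> int"
  assumes "\<And>n. X n \<ge> x" and "\<And>z. z \<ge> x \<Longrightarrow> finite {k. X k = z}"
  shows "filterlim X at_top sequentially"
  unfolding filterlim_at_top
proof
  fix M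
  have "{k. \<not> M \<le> X k} \<subseteq> (\<Union>z\<in>{x..M}. {k. X k = z})" using assms(1) by force
  moreover have "finite (\<Union>z\<in>{x..M}. {k. X k = z})" using assms(2) by auto
  ultimately have "finite {k. \<not> M \<le> X k}" by (rule finite_subset)
  then show "\<forall>\<^sub>F n in sequentially. M \<le> X n"
    by (simp add: eventually_cofinite flip: cofinite_eq_sequentially)
qed

lemma finite_if_visits_bounded:
  assumes "\<And>n. visits X n z \<le> u"
  shows "finite {k. X k = z}"
proof (rule ccontr)
  assume "infinite {k. X k = z}"
  then obtain T where T: "finite T" "card T = Suc u" "T \<subseteq> {k. X k = z}"
    using infinite_arbitrarily_large by blast
  have "card T \<le> visits X (Suc (Max T)) z"
    unfolding visits_def using T by (intro card_mono) (auto simp: less_Suc_eq_le)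
  then show False using T(2) assms[of "Suc (Max T)"] by simp
qed

text \<open>Least action: at a first time when the walk is about to use more arrows at a site than the
  certificate allows, the flux through the edge to the right of that site would be positive,
  although the walk sits to the left of that edge.\<close>

lemma certificate_dominates:
  assumes "is_walk a X" "certificate a x u" "x \<le> X 0"
  shows "x \<le> X n \<and> (\<forall>z\<ge>x. visits X n z \<le> u z)"
proof (induction n)
  case (Suc n)
  have cert: "down_count a x (u x) = 0"
    "\<And>z. z \<ge> x \<Longrightarrow> down_count a (z + 1) (u (z + 1)) < up_count a z (u z)"
    using assms(2) by (auto simp: certificate_def)
  have step: "X (Suc n) = X n + (if a (X n) (Suc (visits X n (X n))) then 1 else - 1)"
    using assms(1) by (auto simp: is_walk_def)
  have less: "visits X n (X n) < u (X n)"
  proof (rule ccontr)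
    assume "\<not> ?thesis"
    moreover have "visits X n (X n) \<le> u (X n)" using Suc by blast
    ultimately have eq: "visits X n (X n) = u (X n)" by simp
    have "int (up_count a (X n) (u (X n)))
        \<le> int (down_count a (X n + 1) (visits X n (X n + 1)))"
      using walk_flux[OF assms(1), of "X n" n] eq by (cases "X n < X 0") auto
    also have "\<dots> \<le> int (down_count a (X n + 1) (u (X n + 1)))"
      using Suc by (auto intro!: down_count_mono)
    also have "\<dots> < int (up_count a (X n) (u (X n)))" using Suc by (auto intro: cert)
    finally show False by simp
  qed
  have "x \<le> X (Suc n)"
  proof (cases "X n = x")
    case True
    \<comment> \<open>A left step from \<open>x\<close> would use a left arrow among the first
      \<open>u x\<close> ones there, and the certificate excludes these.\<close>
    have "down_count a x (Suc (visits X n x)) = 0"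
      using down_count_mono[of "Suc (visits X n x)" "u x" a x] less True cert(1) by auto
    then have "a x (Suc (visits X n x))" by (simp add: down_count_Suc split: if_splits)
    then show ?thesis using step True by simp
  qed (use Suc step in auto)
  moreover have "visits X (Suc n) z \<le> u z" if "z \<ge> x" for z
    using Suc that less by (auto simp: visits_Suc)
  ultimately show ?case by blast
qed (use assms in simp)

lemma good_imp_transient:
  assumes "is_walk a X" "good a x" "x \<le> X 0"
  shows "filterlim X at_top sequentially" "x \<le> X n"
proof -
  obtain u where "certificate a x u" using assms(2) by (auto simp: good_def)
  note dom = certificate_dominates[OF assms(1) this assms(3)]
  show "filterlim X at_top sequentially"
    using dom by (intro filterlim_at_top_if_finite_visits[of x] finite_if_visits_bounded) auto
  show "x \<le> X n" using dom by auto
qed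

section \<open>From transient walks back to good sites\<close>

lemma eventually_greater_int:
  fixes X :: "nat \<Rightarrow> int"
  assumes "filterlim X at_top sequentially"
  shows "eventually (\<lambda>n. X n > z) sequentially"
  using assms by (metis (mono_tags, lifting) eventually_mono filterlim_at_top add1_zle_eq)

lemma eventually_visits_eq:
  assumes "filterlim X at_top sequentially"
  shows "eventually (\<lambda>n. visits X n z = card {k. X k = z}) sequentially"
proof -
  have "eventually (\<lambda>n. X n > z) sequentially"
    using assms by (intro eventually_greater_int)
  then obtain N where N: "\<And>n. n \<ge> N \<Longrightarrow> X n > z" by (auto simp: eventually_sequentially)
  have "visits X n z = card {k. X k = z}" if "n \<ge> N" for n
  proof -
    have "k < n" if "X k = z" for k
      using N[of k] that \<open>n \<ge> N\<close> by (cases "k < n") auto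
    then have "{k. k < n \<and> X k = z} = {k. X k = z}" by blast
    then show ?thesis by (simp add: visits_def)
  qed
  then show ?thesis by (auto simp: eventually_sequentially)
qed

text \<open>This is the limit of \<open>walk_flux\<close>: from some time on the counts at
  \<open>z\<close> and \<open>z + 1\<close> are final and the walk is to the right of
  \<open>z\<close>.\<close>

lemma transient_flux:
  assumes "is_walk a X" "filterlim X at_top sequentially"
  shows "int (up_count a z (card {k. X k = z})) - int (down_count a (z + 1) (card {k. X k = z + 1}))
           = 1 - of_bool (X 0 > z)"
proof -
  have "eventually (\<lambda>n. X n > z) sequentially"
    using assms by (intro eventually_greater_int)
  then have "eventually (\<lambda>n. visits X n z = card {k. X k = z} \<and>
      visits X n (z + 1) = card {k. X k = z + 1} \<and> X n > z) sequentially"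
    using eventually_visits_eq[OF assms(2), of z] eventually_visits_eq[OF assms(2), of "z + 1"]
    by eventually_elim simp
  then obtain n where "visits X n z = card {k. X k = z}"
      "visits X n (z + 1) = card {k. X k = z + 1}" "X n > z"
    using eventually_happens'[OF sequentially_bot] by fast
  then show ?thesis using walk_flux[OF assms(1), of z n] by simp
qed

lemma good_iff_walk:
  assumes "is_walk a X"
  shows "good a (X 0) \<longleftrightarrow> filterlim X at_top sequentially \<and> (\<forall>n. X 0 \<le> X n)"
proof safe
  assume lim: "filterlim X at_top sequentially" and ge: "\<forall>n. X 0 \<le> X n"
  define u where "u z = card {k. X k = z}" for z
  \<comment> \<open>The site \<open>X 0 - 1\<close> is never visited, so no flux crosses the edge to
    its right, and the arrows used at \<open>X 0\<close> include no left arrow.\<close>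
  have "X k \<noteq> X 0 - 1" for k using spec[OF ge, of k] by linarith
  then have "u (X 0 - 1) = 0" by (simp add: u_def)
  then have "down_count a (X 0) (u (X 0)) = 0"
    using transient_flux[OF assms lim, of "X 0 - 1"] by (simp flip: u_def)
  moreover have "down_count a (z + 1) (u (z + 1)) < up_count a z (u z)" if "z \<ge> X 0" for z
    using transient_flux[OF assms lim, of z] that by (simp flip: u_def)
  ultimately show "good a (X 0)" by (auto simp: good_def certificate_def)
qed (use good_imp_transient[OF assms] in auto)

definition force :: "arrows \<Rightarrow> int \<Rightarrow> nat \<Rightarrow> arrows" where
  "force a x k z c \<longleftrightarrow> a z c \<or> z = x \<and> 1 \<le> c \<and> c \<le> k"

text \<open>It suffices to force as many arrows as the given walk uses at its start. The visit
  counts of that walk then form a certificate: forcing removes the left arrows at the start and can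
  only improve the strict inequalities supplied by \<open>transient_flux\<close>, even if the forced
  walk takes another course.\<close>

lemma transient_imp_good_force:
  assumes "is_walk a X" "filterlim X at_top sequentially"
  shows "\<exists>k. good (force a (X 0) k) (X 0)"
proof -
  define u where "u z = card {k. X k = z}" for z
  let ?b = "force a (X 0) (u (X 0))"
  have up: "up_count a z m \<le> up_count ?b z m" for z m
    unfolding up_count_def by (intro card_mono) (auto simp: force_def)
  have down: "down_count ?b z m \<le> down_count a z m" for z m
    unfolding down_count_def by (intro card_mono) (auto simp: force_def)
  have "down_count ?b (X 0) (u (X 0)) = 0" by (auto simp: down_count_def force_def)
  moreover have "down_count ?b (z + 1) (u (z + 1)) < up_count ?b z (u z)" if "z \<ge> X 0" for z
    using transient_flux[OF assms, of z] that up[of z "u z"] down[of "z + 1" "u (z + 1)"]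
    by (simp flip: u_def)
  ultimately show ?thesis by (auto simp: good_def certificate_def)
qed

section \<open>Locality and translation of goodness\<close>

lemma good_cong:
  assumes "\<And>z c. z \<ge> x \<Longrightarrow> c \<ge> 1 \<Longrightarrow> a z c = b z c"
  shows "good a x = good b x"
proof -
  have "up_count a z m = up_count b z m" "down_count a z m = down_count b z m" if "z \<ge> x" for z m
    using that assms by (auto simp: up_count_def down_count_def intro!: arg_cong[where f=card])
  then show ?thesis by (simp add: good_def certificate_def)
qed

lemma good_shift: "good (\<lambda>z. a (z + y)) x = good a (x + y)"
proof -
  have eq: "up_count (\<lambda>z. a (z + y)) z m = up_count a (z + y) m"
    "down_count (\<lambda>z. a (z + y)) z m = down_count a (z + y) m" for z m
    by (auto simp: up_count_def down_count_def)
  have "certificate (\<lambda>z. a (z + y)) x (\<lambda>z. u (z + y))" if "certificate a (x + y) u" for u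
    unfolding certificate_def
  proof (intro conjI allI impI)
    fix z assume "x \<le> z"
    then have "down_count a (z + y + 1) (u (z + y + 1)) < up_count a (z + y) (u (z + y))"
      using that by (auto simp: certificate_def)
    then show "down_count (\<lambda>z. a (z + y)) (z + 1) (u (z + 1 + y))
        < up_count (\<lambda>z. a (z + y)) z (u (z + y))"
      unfolding eq by (simp add: algebra_simps)
  qed (use that in \<open>simp add: certificate_def eq\<close>)
  moreover have "certificate a (x + y) (\<lambda>z. u (z - y))" if "certificate (\<lambda>z. a (z + y)) x u" for u
    unfolding certificate_def
  proof (intro conjI allI impI)
    fix z assume "x + y \<le> z"
    then have "down_count (\<lambda>z. a (z + y)) (z - y + 1) (u (z - y + 1))
        < up_count (\<lambda>z. a (z + y)) (z - y) (u (z - y))"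
      using that by (auto simp: certificate_def)
    then show "down_count a (z + 1) (u (z + 1 - y)) < up_count a z (u (z - y))"
      unfolding eq by (simp add: algebra_simps)
  qed (use that in \<open>simp add: certificate_def eq\<close>)
  ultimately show ?thesis unfolding good_def by blast
qed

lemma is_walk_shift: "is_walk (\<lambda>z. a (z + y)) X \<longleftrightarrow> is_walk a (\<lambda>n. X n + y)"
  by (auto simp: is_walk_def visits_def)

section \<open>The law of a walk driven by independent arrows\<close>

text \<open>The arrows may depend on the time as well. This covers both \<open>erw\<close>, which
  reads a fresh uniform at each time, and walks following fixed stacks, for which
  \<open>\<alpha>\<close> ignores the time.\<close>

fun hist :: "(nat \<Rightarrow> int \<Rightarrow> nat \<Rightarrow> bool) \<Rightarrow> int \<Rightarrow> nat \<Rightarrow> int list" where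
  "hist \<alpha> x 0 = [x]"
| "hist \<alpha> x (Suc n) =
     (let xs = hist \<alpha> x n; y = last xs in
      xs @ [y + (if \<alpha> n y (count_list xs y) then 1 else - 1)])"

definition walk :: "(nat \<Rightarrow> int \<Rightarrow> nat \<Rightarrow> bool) \<Rightarrow> int \<Rightarrow> nat \<Rightarrow> int" where
  "walk \<alpha> x n = last (hist \<alpha> x n)"

lemma hist_eq_map_walk: "hist \<alpha> x n = map (walk \<alpha> x) [0..<Suc n]"
proof (induction n)
  case (Suc n)
  have "hist \<alpha> x (Suc n) = hist \<alpha> x n @ [walk \<alpha> x (Suc n)]"
    by (simp add: walk_def Let_def)
  then show ?case by (simp only: Suc upt_Suc) simp
qed (simp add: walk_def)

lemma walk_0 [simp]: "walk \<alpha> x 0 = x"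
  by (simp add: walk_def)

lemma walk_Suc:
  "walk \<alpha> x (Suc n) = walk \<alpha> x n +
     (if \<alpha> n (walk \<alpha> x n) (count_list (map (walk \<alpha> x) [0..<Suc n]) (walk \<alpha> x n)) then 1 else - 1)"
  unfolding hist_eq_map_walk[symmetric] by (simp add: walk_def Let_def)

lemma count_list_map_upt: "count_list (map X [0..<n]) z = visits X n z"
  by (induction n) (auto simp: visits_Suc)

lemma is_walk_walk: "is_walk a (walk (\<lambda>_. a) x)"
  unfolding is_walk_def walk_Suc by (simp only: count_list_map_upt visits_Suc) simp

lemma is_walk_unique:
  assumes "is_walk a X" "is_walk a Y" "X 0 = Y 0"
  shows "X = Y"
proof -
  have "\<forall>k\<le>n. X k = Y k" for n
  proof (induction n)
    case (Suc n)
    then have "visits X n z = visits Y n z" for z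
      by (auto simp: visits_def intro!: arg_cong[where f=card])
    then have "X (Suc n) = Y (Suc n)"
      using assms(1,2) Suc by (simp add: is_walk_def)
    then show ?case using Suc by (auto simp: le_Suc_eq)
  qed (use assms in simp)
  then show ?thesis by auto
qed

lemma walk_shift: "walk (\<lambda>_ z. a (z + y)) x n + y = walk (\<lambda>_. a) (x + y) n"
proof -
  have "is_walk a (\<lambda>n. walk (\<lambda>_ z. a (z + y)) x n + y)"
    using is_walk_walk is_walk_shift by blast
  from is_walk_unique[OF this is_walk_walk, of "x + y"] show ?thesis
    by (simp add: fun_eq_iff)
qed

text \<open>Once the path \<open>p\<close> is fixed, the sites and visit numbers of the arrows
  involved are deterministic, so the event becomes a finite conjunction of conditions on prescribed
  arrows.\<close>

lemma hist_eq_iff: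
  "hist \<alpha> x n = p \<longleftrightarrow> length p = Suc n \<and> p ! 0 = x \<and>
     (\<forall>k<n. p ! Suc k = p ! k +
        (if \<alpha> k (p ! k) (count_list (take (Suc k) p) (p ! k)) then 1 else - 1))"
  (is "_ \<longleftrightarrow> ?R")
proof
  assume p: "hist \<alpha> x n = p"
  have nth: "p ! k = walk \<alpha> x k" if "k \<le> n" for k
    using that unfolding p[symmetric] hist_eq_map_walk by (simp del: upt_Suc)
  moreover have "take (Suc k) p = map (walk \<alpha> x) [0..<Suc k]" if "k < n" for k
    using that unfolding p[symmetric] hist_eq_map_walk by (simp add: take_map del: upt_Suc)
  ultimately show ?R
    using walk_Suc[of \<alpha> x] by (simp add: hist_eq_map_walk flip: p del: upt_Suc)
next
  assume R: ?R
  have "\<forall>j\<le>k. p ! j = walk \<alpha> x j" if "k \<le> n" for k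
    using that
  proof (induction k)
    case (Suc k)
    then have IH: "\<forall>j\<le>k. p ! j = walk \<alpha> x j" by simp
    have "take (Suc k) p = map (walk \<alpha> x) [0..<Suc k]"
      using IH R Suc(2) by (intro nth_equalityI) (auto simp del: upt_Suc)
    then have "p ! Suc k = walk \<alpha> x (Suc k)"
      using R IH Suc(2) walk_Suc[of \<alpha> x k] by (simp del: upt_Suc)
    then show ?case using IH by (auto simp: le_Suc_eq)
  qed (use R in simp)
  then show "hist \<alpha> x n = p"
    unfolding hist_eq_map_walk using R
    by (intro nth_equalityI) (auto simp: less_Suc_eq_le simp del: upt_Suc)
qed

lemma erw_eq_walk: "erw \<omega> x u = walk (\<lambda>k z c. u (Suc k) < \<omega> (z, c)) x"
proof -
  have "erw_hist \<omega> x u n = hist (\<lambda>k z c. u (Suc k) < \<omega> (z, c)) x n" for n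
    by (induction n) (simp_all add: Let_def)
  then show ?thesis by (simp add: erw_def walk_def fun_eq_iff)
qed

text \<open>Negation is injective, so mirroring preserves visit counts and only flips the arrows.
  This turns transience to the left into transience to the right.\<close>

lemma walk_uminus: "- walk \<alpha> x n = walk (\<lambda>k z c. \<not> \<alpha> k (- z) c) (- x) n"
proof -
  have cnt: "count_list (map uminus xs) (- z) = count_list xs z" for xs :: "int list" and z
    by (induction xs) auto
  have "map uminus (hist \<alpha> x n) = hist (\<lambda>k z c. \<not> \<alpha> k (- z) c) (- x) n"
  proof (induction n)
    case (Suc n)
    have "hist \<alpha> x n \<noteq> []" by (simp add: hist_eq_map_walk)
    then show ?case by (simp add: Let_def last_map cnt flip: Suc)
  qed simp
  moreover have "hist \<alpha> x n \<noteq> []" by (simp add: hist_eq_map_walk)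
  ultimately show ?thesis unfolding walk_def by (metis last_map)
qed

section \<open>Measurability of walks and of goodness\<close>

lemma measurable_hist [measurable]:
  assumes [measurable]: "\<And>k z c. Measurable.pred M (\<lambda>w. \<alpha> w k z c)"
  shows "(\<lambda>w. hist (\<alpha> w) x n) \<in> measurable M (count_space UNIV)"
proof (induction n)
  case (Suc n)
  note Suc [measurable]
  \<comment> \<open>There are only countably many histories, so it is enough that the next step is
    measurable for each fixed history.\<close>
  have "(\<lambda>w. (\<lambda>xs w. xs @ [last xs + (if \<alpha> w n (last xs) (count_list xs (last xs)) then 1 else - 1)])
      (hist (\<alpha> w) x n) w) \<in> measurable M (count_space UNIV)"
    by (rule measurable_compose_countable) measurable
  then show ?case by (simp add: Let_def)
qed simp

lemma measurable_walk [measurable]: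
  assumes [measurable]: "\<And>k z c. Measurable.pred M (\<lambda>w. \<alpha> w k z c)"
  shows "(\<lambda>w. walk (\<alpha> w) x n) \<in> measurable M (count_space UNIV)"
  unfolding walk_def by measurable

lemma filterlim_at_top_int_iff:
  "filterlim (X :: nat \<Rightarrow> int) at_top sequentially \<longleftrightarrow> (\<forall>b. \<exists>N. \<forall>n\<ge>N. b \<le> X n)"
  by (simp add: filterlim_at_top eventually_sequentially)

lemma pred_filterlim_at_top_int [measurable]:
  fixes X :: "'a \<Rightarrow> nat \<Rightarrow> int"
  assumes [measurable]: "\<And>n. (\<lambda>w. X w n) \<in> measurable M (count_space UNIV)"
  shows "Measurable.pred M (\<lambda>w. filterlim (X w) at_top sequentially)"
  unfolding filterlim_at_top_int_iff by measurable

text \<open>The definition of \<open>good\<close> quantifies over uncountably many functions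
  \<open>u\<close>; the description by the walk needs only countable quantifiers.\<close>

lemma pred_good [measurable]:
  assumes [measurable]: "\<And>z c. Measurable.pred M (\<lambda>w. a w z c)"
  shows "Measurable.pred M (\<lambda>w. good (a w) x)"
proof -
  have "good (a w) x \<longleftrightarrow> filterlim (walk (\<lambda>_. a w) x) at_top sequentially \<and>
      (\<forall>n. x \<le> walk (\<lambda>_. a w) x n)" for w
    using good_iff_walk[OF is_walk_walk, of "a w" x] by simp
  then show ?thesis by simp
qed

text \<open>Arrows read at different times may come from different sources of randomness.
  Independence is demanded only along sequences in which no pair of site and visit number repeats,
  which is all that a walk can produce.\<close>

locale arrow_system = prob_space M for M :: "'a measure" +
  fixes \<alpha> :: "'a \<Rightarrow> nat \<Rightarrow> int \<Rightarrow> nat \<Rightarrow> bool" and q :: "int \<Rightarrow> nat \<Rightarrow> real"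
  assumes pred_arrow [measurable]: "\<And>k z c. Measurable.pred M (\<lambda>w. \<alpha> w k z c)"
    and prob_arrows: "\<And>n z c s. inj_on (\<lambda>k. (z k, c k)) {..<n} \<Longrightarrow>
      prob {w \<in> space M. \<forall>k<n. \<alpha> w k (z k) (c k) = s k} =
        (\<Prod>k<n. if s k then q (z k) (c k) else 1 - q (z k) (c k))"
begin

definition path_prob :: "int \<Rightarrow> nat \<Rightarrow> int list \<Rightarrow> real" where
  "path_prob x n p =
    (if length p = Suc n \<and> p ! 0 = x \<and> (\<forall>k<n. p ! Suc k = p ! k + 1 \<or> p ! Suc k = p ! k - 1)
     then \<Prod>k<n. let r = q (p ! k) (count_list (take (Suc k) p) (p ! k)) in
       if p ! Suc k = p ! k + 1 then r else 1 - r
     else 0)"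

text \<open>The visit number grows strictly between two visits to the same site, so no arrow is read
  twice along a path and the product formula \<open>prob_arrows\<close> applies.\<close>

lemma prob_hist: "prob {w \<in> space M. hist (\<alpha> w) x n = p} = path_prob x n p"
proof (cases "length p = Suc n \<and> p ! 0 = x \<and>
    (\<forall>k<n. p ! Suc k = p ! k + 1 \<or> p ! Suc k = p ! k - 1)")
  case True
  define c where "c k = count_list (take (Suc k) p) (p ! k)" for k
  have "c j < c k" if "j < k" "k < n" "p ! j = p ! k" for j k
  proof -
    have "take (Suc k) p = take (Suc j) p @ take (k - j) (drop (Suc j) p)"
      using that take_add[of "Suc j" "k - j" p] by simp
    \<comment> \<open>The visit at time \<open>k\<close> lies in the stretch after time
      \<open>j\<close>, at offset \<open>k - Suc j\<close>, and makes the count strictly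
      larger.\<close>
    moreover have "p ! k \<in> set (take (k - j) (drop (Suc j) p))"
      using that True by (auto simp: in_set_conv_nth intro!: exI[of _ "k - Suc j"])
    ultimately show ?thesis
      using that by (simp add: c_def count_list_0_iff neq0_conv[symmetric] del: neq0_conv)
  qed
  then have "inj_on (\<lambda>k. (p ! k, c k)) {..<n}"
    by (intro inj_onI) (metis lessThan_iff linorder_neqE_nat order_less_irrefl prod.inject)
  from prob_arrows[OF this, of "\<lambda>k. p ! Suc k = p ! k + 1", unfolded c_def]
  have "prob {w \<in> space M. \<forall>k<n. \<alpha> w k (p ! k) (c k) = (p ! Suc k = p ! k + 1)} = path_prob x n p"
    using True by (simp add: path_prob_def c_def Let_def cong: if_cong)
  also have "{w \<in> space M. \<forall>k<n. \<alpha> w k (p ! k) (c k) = (p ! Suc k = p ! k + 1)} =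
      {w \<in> space M. hist (\<alpha> w) x n = p}"
    unfolding hist_eq_iff c_def using True by auto
  finally show ?thesis .
next
  case False
  then have "{w \<in> space M. hist (\<alpha> w) x n = p} = {}"
    unfolding hist_eq_iff by auto
  then show ?thesis unfolding path_prob_def if_not_P[OF False] by (simp only: measure_empty)
qed

end

text \<open>The numbers \<open>q z c\<close> determine the probabilities of all finite paths, hence
  the law of the whole walk, whichever mechanism generates the arrows.\<close>

lemma prob_transient_eq:
  assumes "arrow_system M \<alpha> q" "arrow_system N \<beta> r"
    and eq: "\<And>z c. c \<ge> 1 \<Longrightarrow> q z c = r z c"
  shows "measure M {w \<in> space M. filterlim (walk (\<alpha> w) x) at_top sequentially} =
    measure N {w \<in> space N. filterlim (walk (\<beta> w) x) at_top sequentially}"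
proof -
  interpret A: arrow_system M \<alpha> q by fact
  interpret B: arrow_system N \<beta> r by fact
  \<comment> \<open>The current visit is included in the count, so agreement of \<open>q\<close> and
    \<open>r\<close> at \<open>c \<ge> 1\<close> suffices.\<close>
  have "count_list (take (Suc k) p) (p ! k) \<ge> 1" if "k < length p" for p :: "int list" and k
    using that by (simp add: take_Suc_conv_app_nth)
  then have "A.path_prob x n p = B.path_prob x n p" for n p
    by (auto simp: A.path_prob_def B.path_prob_def Let_def eq intro!: prod.cong)
  let ?C = "count_space (UNIV :: int set)"
  let ?P = "PiM (UNIV :: nat set) (\<lambda>_. ?C)"
  have A_walk [measurable]: "(\<lambda>w. walk (\<alpha> w) x) \<in> measurable M ?P"
    by (rule measurable_PiM_single') auto
  have B_walk [measurable]: "(\<lambda>w. walk (\<beta> w) x) \<in> measurable N ?P"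
    by (rule measurable_PiM_single') auto
  have hist: "distr M (count_space UNIV) (\<lambda>w. hist (\<alpha> w) x n) =
      distr N (count_space UNIV) (\<lambda>w. hist (\<beta> w) x n)" for n
  proof (rule measure_eqI_countable[of _ UNIV])
    fix p :: "int list"
    have "emeasure (distr M (count_space UNIV) (\<lambda>w. hist (\<alpha> w) x n)) {p} =
        emeasure M {w \<in> space M. hist (\<alpha> w) x n = p}"
      by (subst emeasure_distr) (auto intro!: arg_cong2[where f=emeasure])
    also have "\<dots> = emeasure N {w \<in> space N. hist (\<beta> w) x n = p}"
      by (simp add: A.emeasure_eq_measure B.emeasure_eq_measure A.prob_hist B.prob_hist
          \<open>A.path_prob x n p = B.path_prob x n p\<close>)
    also have "\<dots> = emeasure (distr N (count_space UNIV) (\<lambda>w. hist (\<beta> w) x n)) {p}"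
      by (subst emeasure_distr) (auto intro!: arg_cong2[where f=emeasure])
    finally show "emeasure (distr M (count_space UNIV) (\<lambda>w. hist (\<alpha> w) x n)) {p} = \<dots>" .
  qed auto
  have distr_eq: "distr M ?P (\<lambda>w. walk (\<alpha> w) x) = distr N ?P (\<lambda>w. walk (\<beta> w) x)"
  proof (rule measure_eqI_PiM_infinite)
    fix A and J :: "nat set" assume J: "finite J"
    \<comment> \<open>A cylinder event over the times in \<open>J\<close> is decided by the history
      up to a horizon \<open>n\<close> not before any of them; inserting 0 covers empty
      \<open>J\<close>.\<close>
    define n where "n = Max (insert 0 J)"
    have le: "j \<le> n" if "j \<in> J" for j using that J by (simp add: n_def)
    define S where "S = {l :: int list. \<forall>j\<in>J. l ! j \<in> A j}"
    have iff: "walk \<gamma> x \<in> prod_emb UNIV (\<lambda>_. ?C) J (Pi\<^sub>E J A) \<longleftrightarrow> hist \<gamma> x n \<in> S" for \<gamma>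
      using le by (auto simp: prod_emb_def S_def hist_eq_map_walk less_Suc_eq_le nth_map simp del: upt_Suc)
    have sets: "prod_emb UNIV (\<lambda>_. ?C) J (Pi\<^sub>E J A) \<in> sets ?P"
      using J by (intro sets_PiM_I) auto
    have "emeasure (distr M ?P (\<lambda>w. walk (\<alpha> w) x)) (prod_emb UNIV (\<lambda>_. ?C) J (Pi\<^sub>E J A)) =
        emeasure (distr M (count_space UNIV) (\<lambda>w. hist (\<alpha> w) x n)) S"
      using sets by (simp add: emeasure_distr) (simp add: vimage_def iff)
    moreover have "emeasure (distr N ?P (\<lambda>w. walk (\<beta> w) x)) (prod_emb UNIV (\<lambda>_. ?C) J (Pi\<^sub>E J A)) =
        emeasure (distr N (count_space UNIV) (\<lambda>w. hist (\<beta> w) x n)) S"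
      using sets by (simp add: emeasure_distr) (simp add: vimage_def iff)
    ultimately show "emeasure (distr M ?P (\<lambda>w. walk (\<alpha> w) x)) (prod_emb UNIV (\<lambda>_. ?C) J (Pi\<^sub>E J A)) =
        emeasure (distr N ?P (\<lambda>w. walk (\<beta> w) x)) (prod_emb UNIV (\<lambda>_. ?C) J (Pi\<^sub>E J A))"
      by (simp add: hist)
  next
    show "finite_measure (distr M ?P (\<lambda>w. walk (\<alpha> w) x))"
      using A.prob_space_distr[OF A_walk] by (rule prob_space.finite_measure)
  qed auto
  let ?T = "{X \<in> space ?P. filterlim X at_top sequentially}"
  have T: "?T \<in> sets ?P" by measurable
  have "measure M {w \<in> space M. filterlim (walk (\<alpha> w) x) at_top sequentially} =
      measure (distr M ?P (\<lambda>w. walk (\<alpha> w) x)) ?T"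
    using T by (simp add: measure_distr) (auto simp: space_PiM intro!: arg_cong2[where f=measure])
  moreover have "measure N {w \<in> space N. filterlim (walk (\<beta> w) x) at_top sequentially} =
      measure (distr N ?P (\<lambda>w. walk (\<beta> w) x)) ?T"
    using T by (simp add: measure_distr) (auto simp: space_PiM intro!: arg_cong2[where f=measure])
  ultimately show ?thesis by (simp add: distr_eq)
qed

section \<open>Site-driven arrows\<close>

definition uniform01 :: "real measure" where
  "uniform01 = uniform_measure lborel {0..1}"

lemma sets_uniform01 [simp, measurable_cong]: "sets uniform01 = sets borel"
  and space_uniform01 [simp]: "space uniform01 = UNIV"
  by (simp_all add: uniform01_def)

interpretation uniform01: prob_space uniform01
  unfolding uniform01_def by (rule prob_space_uniform_measure) auto

interpretation uniform01_product: product_prob_space "\<lambda>_. uniform01" I for I :: "'i set"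
  by unfold_locales

lemma measure_uniform01:
  assumes "A \<in> sets borel" shows "measure uniform01 A = measure lborel ({0..1} \<inter> A)"
  using assms unfolding uniform01_def
  by (subst measure_uniform_measure) auto

lemma measure_uniform01_lessThan:
  assumes "0 \<le> t" "t \<le> 1" shows "measure uniform01 {..<t} = t"
proof -
  have "{0..1} \<inter> {..<t} = {0..<t}" using assms by auto
  then show ?thesis using assms by (simp add: measure_uniform01)
qed

lemma measure_uniform01_atLeast:
  assumes "0 \<le> t" "t \<le> 1" shows "measure uniform01 {t..} = 1 - t"
proof -
  have "{0..1} \<inter> {t..} = {t..1}" using assms by auto
  then show ?thesis using assms by (simp add: measure_uniform01)
qed

text \<open>The map \<open>e\<close> selects the uniform variable to be read: \<open>Suc k\<close>
  for \<open>erw\<close> and \<open>(z, c)\<close> for fixed stacks. Injectivity ensures that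
  distinct arrows along a path read distinct, hence independent, variables.\<close>

lemma arrow_system_iid:
  fixes e :: "nat \<Rightarrow> int \<Rightarrow> nat \<Rightarrow> 'i" and B :: "int \<Rightarrow> nat \<Rightarrow> real set"
  assumes B: "\<And>z c. B z c \<in> sets borel"
    and inj: "\<And>n z c. inj_on (\<lambda>k. (z k, c k)) {..<n} \<Longrightarrow> inj_on (\<lambda>k. e k (z k) (c k)) {..<n}"
  shows "arrow_system (PiM UNIV (\<lambda>_. uniform01)) (\<lambda>v k z c. v (e k z c) \<in> B z c)
    (\<lambda>z c. measure uniform01 (B z c))"
proof -
  let ?M = "PiM (UNIV :: 'i set) (\<lambda>_. uniform01)"
  have "measure ?M {v \<in> space ?M. \<forall>k<n. (v (e k (z k) (c k)) \<in> B (z k) (c k)) = s k} =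
      (\<Prod>k<n. if s k then measure uniform01 (B (z k) (c k)) else 1 - measure uniform01 (B (z k) (c k)))"
    if "inj_on (\<lambda>k. (z k, c k)) {..<n}" for n z c and s :: "nat \<Rightarrow> bool"
  proof -
    let ?e = "\<lambda>k. e k (z k) (c k)"
    let ?X = "\<lambda>k. if s k then B (z k) (c k) else - B (z k) (c k)"
    \<comment> \<open>The inverse of \<open>?e\<close> recovers the time at which a variable is
      read, and so the constraint imposed on it.\<close>
    let ?Y = "\<lambda>i. ?X (the_inv_into {..<n} ?e i)"
    have inj: "inj_on ?e {..<n}" using inj that .
    have Y: "?Y (?e k) = ?X k" if "k < n" for k
      using that the_inv_into_f_f[OF inj, of k] by simp
    have "{v \<in> space ?M. \<forall>k<n. (v (?e k) \<in> B (z k) (c k)) = s k} =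
        {v \<in> space ?M. \<forall>i\<in>?e ` {..<n}. v i \<in> ?Y i}"
      using Y by auto
    then have "emeasure ?M {v \<in> space ?M. \<forall>k<n. (v (?e k) \<in> B (z k) (c k)) = s k} =
        (\<Prod>i\<in>?e ` {..<n}. emeasure uniform01 (?Y i))"
      using B by (simp only:) (rule uniform01_product.emeasure_PiM_Collect, auto)
    also have "\<dots> = (\<Prod>k<n. emeasure uniform01 (?Y (?e k)))"
      using inj by (rule prod.reindex_cong) auto
    also have "\<dots> = (\<Prod>k<n. emeasure uniform01 (?X k))"
      using Y by (intro prod.cong) auto
    also have "\<dots> = ennreal (\<Prod>k<n. measure uniform01 (?X k))"
      by (simp add: uniform01.emeasure_eq_measure prod_ennreal)
    finally have "measure ?M {v \<in> space ?M. \<forall>k<n. (v (?e k) \<in> B (z k) (c k)) = s k} =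
        (\<Prod>k<n. measure uniform01 (?X k))"
      by (simp add: measure_def prod_nonneg)
    also have "\<dots> = (\<Prod>k<n. if s k then measure uniform01 (B (z k) (c k))
        else 1 - measure uniform01 (B (z k) (c k)))"
      using B uniform01.prob_compl by (intro prod.cong) (auto simp: Compl_eq_Diff_UNIV)
    finally show ?thesis .
  qed
  moreover have "Measurable.pred ?M (\<lambda>v. v (e k z c) \<in> B z c)" for k z c
    using B by measurable
  ultimately show ?thesis
    by (intro arrow_system.intro arrow_system_axioms.intro) (auto intro: prob_space_PiM uniform01.prob_space_axioms)
qed

text \<open>Attaching the uniforms to sites and visit numbers couples the walks from all starting
  points: they follow the same stacks, as the comparison with a good site requires.\<close>

definition site_uniforms :: "(int \<times> nat \<Rightarrow> real) measure" where
  "site_uniforms = PiM UNIV (\<lambda>_. uniform01)"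

interpretation site_uniforms: prob_space site_uniforms
  unfolding site_uniforms_def by (intro prob_space_PiM uniform01.prob_space_axioms)

lemma measurable_site_uniforms [measurable]: "(\<lambda>v. v i) \<in> borel_measurable site_uniforms"
  unfolding site_uniforms_def by measurable

lemma space_site_uniforms [simp]: "space site_uniforms = UNIV"
  by (simp add: site_uniforms_def space_PiM)

definition arr :: "(int \<times> nat \<Rightarrow> real) \<Rightarrow> (int \<times> nat \<Rightarrow> real) \<Rightarrow> arrows" where
  "arr \<omega> v z c \<longleftrightarrow> v (z, c) < \<omega> (z, c)"

lemma pred_arr [measurable]: "Measurable.pred site_uniforms (\<lambda>v. arr \<omega> v z c)"
  unfolding arr_def by measurable

lemma measurable_Omega_component [measurable]: "(\<lambda>\<omega>. \<omega> i) \<in> borel_measurable Omega"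
proof (cases "i \<in> cookie_index")
  case True
  then have "(\<lambda>\<omega>. \<omega> i) \<in> measurable Omega (restrict_space borel {0..1})"
    unfolding Omega_def by (rule measurable_component_singleton)
  then show ?thesis by (rule measurable_restrict_space2_iff[THEN iffD1, THEN conjunct1])
next
  case False
  \<comment> \<open>Off \<open>cookie_index\<close>, points of the product space are extensional, so
    this coordinate is constant.\<close>
  then have "(\<lambda>\<omega>. \<omega> i) \<in> borel_measurable Omega \<longleftrightarrow>
      (\<lambda>\<omega>. undefined :: real) \<in> borel_measurable Omega"
    by (intro measurable_cong) (cases i, auto simp: Omega_def space_PiM PiE_def extensional_def)
  then show ?thesis by simp
qed

lemma pred_arr_joint [measurable]:
  "Measurable.pred (Omega \<Otimes>\<^sub>M site_uniforms) (\<lambda>p. arr (fst p) (snd p) z c)"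
  unfolding arr_def by measurable

lemma Omega_bounds: "\<omega> \<in> space Omega \<Longrightarrow> c \<ge> 1 \<Longrightarrow> 0 \<le> \<omega> (z, c) \<and> \<omega> (z, c) \<le> 1"
  by (auto simp: Omega_def space_PiM space_restrict_space cookie_index_def PiE_def Pi_def)

definition transient :: "int \<Rightarrow> arrows \<Rightarrow> bool" where
  "transient x a \<longleftrightarrow> filterlim (walk (\<lambda>_. a) x) at_top sequentially"

definition env_prob :: "(int \<times> nat \<Rightarrow> real) \<Rightarrow> (arrows \<Rightarrow> bool) \<Rightarrow> real" where
  "env_prob \<omega> P = measure site_uniforms {v. P (arr \<omega> v)}"

lemma arrow_system_site:
  "arrow_system site_uniforms (\<lambda>v k z c. arr \<omega> v z c) (\<lambda>z c. measure uniform01 {..<\<omega> (z, c)})"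
  using arrow_system_iid[of "\<lambda>z c. {..<\<omega> (z, c)}" "\<lambda>k z c. (z, c)"]
  by (simp add: site_uniforms_def arr_def)

lemma Unif_eq: "Unif = PiM UNIV (\<lambda>_. uniform01)"
  by (simp add: Unif_def uniform01_def)

text \<open>No cookie is read twice by one walk, so a fresh uniform at each time and one uniform per
  cookie yield the same law.\<close>

lemma quenched_right_eq: "quenched_right \<omega> x = env_prob \<omega> (transient x)"
proof -
  have "arrow_system Unif (\<lambda>u k z c. u (Suc k) \<in> {..<\<omega> (z, c)})
      (\<lambda>z c. measure uniform01 {..<\<omega> (z, c)})"
    unfolding Unif_eq by (rule arrow_system_iid) (auto simp: inj_on_def)
  from prob_transient_eq[OF this arrow_system_site] show ?thesis
    by (simp add: quenched_right_def erw_eq_walk env_prob_def transient_def)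
qed

lemma filterlim_at_bot_int_iff:
  "filterlim (X :: nat \<Rightarrow> int) at_bot sequentially \<longleftrightarrow> filterlim (\<lambda>n. - X n) at_top sequentially"
proof -
  have "(\<forall>b. eventually (\<lambda>n. X n \<le> b) sequentially) \<longleftrightarrow>
      (\<forall>b. eventually (\<lambda>n. X n \<le> - b) sequentially)"
    by (metis minus_minus)
  then show ?thesis by (simp add: filterlim_at_bot filterlim_at_top le_minus_iff)
qed

text \<open>Mirroring exchanges right and left jumps, hence \<open>1 - \<omega> (- z, c)\<close>.
  The value \<open>undefined\<close> at \<open>c = 0\<close> keeps the result in the extensional
  space of \<open>Omega\<close>.\<close>

definition reflect :: "(int \<times> nat \<Rightarrow> real) \<Rightarrow> (int \<times> nat \<Rightarrow> real)" where
  "reflect \<omega> = (\<lambda>(z, c). if c \<ge> 1 then 1 - \<omega> (- z, c) else undefined)"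

text \<open>The mirrored walk jumps right when its uniform lies in
  \<open>{\<omega> (- z, c)..}\<close>, while \<open>reflect\<close> uses
  \<open>{..<1 - \<omega> (- z, c)}\<close>. The events differ but have equal probability, so
  \<open>prob_transient_eq\<close> links the two walks.\<close>

lemma quenched_left_eq:
  assumes "\<omega> \<in> space Omega"
  shows "quenched_left \<omega> x = env_prob (reflect \<omega>) (transient (- x))"
proof -
  have system: "arrow_system Unif (\<lambda>u k z c. u (Suc k) \<in> {\<omega> (- z, c)..})
      (\<lambda>z c. measure uniform01 {\<omega> (- z, c)..})"
    unfolding Unif_eq by (rule arrow_system_iid) (auto simp: inj_on_def)
  have eq: "measure uniform01 {\<omega> (- z, c)..} = measure uniform01 {..<reflect \<omega> (z, c)}"
    if "c \<ge> 1" for z c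
    using that Omega_bounds[OF assms, of c "- z"]
    by (simp add: measure_uniform01_atLeast measure_uniform01_lessThan reflect_def)
  have "measure Unif {u \<in> space Unif.
        filterlim (walk (\<lambda>k z c. u (Suc k) \<in> {\<omega> (- z, c)..}) (- x)) at_top sequentially} =
      env_prob (reflect \<omega>) (transient (- x))"
    using prob_transient_eq[OF system arrow_system_site eq] by (simp add: env_prob_def transient_def)
  moreover have "filterlim (erw \<omega> x u) at_bot sequentially \<longleftrightarrow>
      filterlim (walk (\<lambda>k z c. u (Suc k) \<in> {\<omega> (- z, c)..}) (- x)) at_top sequentially" for u
  proof -
    have "walk (\<lambda>k z c. u (Suc k) \<in> {\<omega> (- z, c)..}) (- x) = (\<lambda>n. - erw \<omega> x u n)"
      by (simp add: erw_eq_walk walk_uminus not_less fun_eq_iff)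
    then show ?thesis by (simp add: filterlim_at_bot_int_iff)
  qed
  ultimately show ?thesis by (simp add: quenched_left_def)
qed

section \<open>Events of the random arrow environment\<close>

text \<open>Measurability is checked once on the space of all stacks.
  \<open>pred_arrow_event\<close> then pulls it back along any random arrows: for fixed
  \<open>\<omega>\<close>, jointly in environment and uniforms, or for modified arrows.\<close>

definition arrow_event :: "(arrows \<Rightarrow> bool) \<Rightarrow> bool" where
  "arrow_event P \<longleftrightarrow>
     Measurable.pred (PiM UNIV (\<lambda>_ :: int \<times> nat. count_space (UNIV :: bool set))) (\<lambda>b. P (\<lambda>z c. b (z, c)))"

lemma pred_arrow_event:
  assumes "arrow_event P" and [measurable]: "\<And>z c. Measurable.pred M (\<lambda>w. a w z c)"
  shows "Measurable.pred M (\<lambda>w. P (a w))"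
proof -
  let ?B = "PiM UNIV (\<lambda>_ :: int \<times> nat. count_space (UNIV :: bool set))"
  have "(\<lambda>w (z, c). a w z c) \<in> measurable M ?B"
    by (rule measurable_PiM_single') (auto simp: split_beta space_PiM)
  from measurable_compose[OF this assms(1)[unfolded arrow_event_def]] show ?thesis by simp
qed

lemma arrow_event_good: "arrow_event (\<lambda>a. good a x)"
  unfolding arrow_event_def by measurable

lemma arrow_event_transient: "arrow_event (transient x)"
  unfolding arrow_event_def transient_def by measurable

lemma arrow_event_Ex: "(\<And>i :: 'i :: countable. arrow_event (P i)) \<Longrightarrow> arrow_event (\<lambda>a. \<exists>i. P i a)"
  unfolding arrow_event_def by measurable

lemma arrow_event_All: "(\<And>i :: 'i :: countable. arrow_event (P i)) \<Longrightarrow> arrow_event (\<lambda>a. \<forall>i. P i a)"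
  unfolding arrow_event_def by measurable

lemma arrow_event_const_conj: "arrow_event P \<Longrightarrow> arrow_event (\<lambda>a. b \<and> P a)"
  unfolding arrow_event_def by measurable

lemma sets_arrow_event:
  assumes "arrow_event P"
  shows "{v. P (arr \<omega> v)} \<in> sets site_uniforms"
proof -
  have "Measurable.pred site_uniforms (\<lambda>v. P (arr \<omega> v))"
    using assms by (rule pred_arrow_event) measurable
  then show ?thesis by (simp add: pred_def)
qed

lemma arrow_event_Bex_good: "arrow_event (\<lambda>a. \<exists>x\<in>S. good a x)"
  unfolding Bex_def by (intro arrow_event_Ex arrow_event_const_conj arrow_event_good)

section \<open>Quenched probabilities of arrow events\<close>

lemma env_prob_mono:
  assumes "arrow_event Q" "\<And>a. P a \<Longrightarrow> Q a"
  shows "env_prob \<omega> P \<le> env_prob \<omega> Q"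
  unfolding env_prob_def
  using assms by (intro site_uniforms.finite_measure_mono sets_arrow_event) auto

lemma env_prob_bounds: "0 \<le> env_prob \<omega> P" "env_prob \<omega> P \<le> 1"
  by (simp_all add: env_prob_def)

lemma borel_measurable_env_prob:
  assumes "arrow_event P"
  shows "(\<lambda>\<omega>. env_prob \<omega> P) \<in> borel_measurable Omega"
proof -
  have "Measurable.pred (Omega \<Otimes>\<^sub>M site_uniforms) (\<lambda>p. P (arr (fst p) (snd p)))"
    using assms by (rule pred_arrow_event) measurable
  then have "{p \<in> space (Omega \<Otimes>\<^sub>M site_uniforms). P (arr (fst p) (snd p))}
      \<in> sets (Omega \<Otimes>\<^sub>M site_uniforms)" by simp
  then have "(\<lambda>\<omega>. emeasure site_uniforms
      (Pair \<omega> -` {p \<in> space (Omega \<Otimes>\<^sub>M site_uniforms). P (arr (fst p) (snd p))}))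
      \<in> borel_measurable Omega"
    by (rule site_uniforms.measurable_emeasure_Pair)
  then have "(\<lambda>\<omega>. emeasure site_uniforms {v. P (arr \<omega> v)}) \<in> borel_measurable Omega"
    by (rule measurable_cong[THEN iffD1, rotated])
       (auto simp: space_pair_measure intro!: arg_cong2[where f=emeasure])
  then show ?thesis unfolding env_prob_def measure_def by measurable
qed

text \<open>Translating the uniforms along with the environment preserves their law, so a shift of
  the environment can be traded for a shift of the arrows.\<close>

lemma env_prob_shift:
  assumes "arrow_event P"
  shows "env_prob (shift \<omega>) P = env_prob \<omega> (\<lambda>a. P (\<lambda>z. a (z + 1)))"
proof -
  let ?s = "\<lambda>i :: int \<times> nat. (fst i + 1, snd i)"
  have "distr site_uniforms site_uniforms (\<lambda>v i. v (?s i)) = site_uniforms"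
    using distr_PiM_reindex[of UNIV "\<lambda>_. uniform01" ?s UNIV] uniform01.prob_space_axioms
    by (simp add: site_uniforms_def inj_on_def prod_eq_iff restrict_UNIV)
  then have "env_prob (shift \<omega>) P =
      measure (distr site_uniforms site_uniforms (\<lambda>v i. v (?s i))) {v. P (arr (shift \<omega>) v)}"
    by (simp add: env_prob_def)
  also have "\<dots> = measure site_uniforms {v. P (arr (shift \<omega>) (\<lambda>i. v (?s i)))}"
  proof -
    have "(\<lambda>v i. v (?s i)) \<in> measurable site_uniforms site_uniforms"
      unfolding site_uniforms_def by (rule measurable_PiM_single') (auto simp: space_PiM)
    from measure_distr[OF this sets_arrow_event[OF assms]] show ?thesis by (simp add: vimage_def)
  qed
  also have "\<dots> = env_prob \<omega> (\<lambda>a. P (\<lambda>z. a (z + 1)))"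
    by (simp add: env_prob_def arr_def[abs_def] shift_def)
  finally show ?thesis .
qed

section \<open>Independence of the uniforms and its consequences\<close>

lemma indep_vars_coordinates:
  "site_uniforms.indep_vars (\<lambda>_. uniform01) (\<lambda>i v. v i) UNIV"
proof (subst site_uniforms.indep_vars_iff_distr_eq_PiM')
  have "distr site_uniforms uniform01 (\<lambda>v. v i) = uniform01" for i
    unfolding site_uniforms_def by (rule uniform01_product.PiM_component) simp
  then show "distr site_uniforms (PiM UNIV (\<lambda>_. uniform01)) (\<lambda>x. \<lambda>i\<in>UNIV. x i) =
      PiM UNIV (\<lambda>i. distr site_uniforms uniform01 (\<lambda>v. v i))"
    by (simp add: distr_id2 site_uniforms_def restrict_UNIV)
qed auto

text \<open>The event only depends on the arrows to the right of any given site, so Kolmogorov's law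
  applies to the groups of uniforms attached to the sites 0, 1, 2, and so on.\<close>

lemma env_prob_good_io_zero_one:
  "env_prob \<omega> (\<lambda>a. \<forall>m. \<exists>x\<in>{m::int..}. good a x) \<in> {0, 1}"
proof -
  let ?P = "\<lambda>a. \<forall>m. \<exists>x\<in>{m::int..}. good a x"
  define K where "K n = {int n} \<times> (UNIV :: nat set)" for n
  let ?N = "\<lambda>n. PiM (K n) (\<lambda>_. uniform01)"
  define r where "r n v = restrict v (K n)" for n and v :: "int \<times> nat \<Rightarrow> real"
  define A where "A n = sets (vimage_algebra UNIV (r n) (?N n))" for n
  have r: "r n \<in> measurable site_uniforms (?N n)" for n
    unfolding r_def site_uniforms_def by (rule measurable_restrict_subset) simp
  have A_eq: "A = (\<lambda>n. {r n -` B |B. B \<in> sets (?N n)})"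
    unfolding A_def using r[THEN measurable_space]
    by (subst sets_vimage_algebra2) (auto simp: space_PiM r_def)
  from indep_vars_coordinates have "site_uniforms.indep_vars (\<lambda>n. ?N n) (\<lambda>n v. restrict (\<lambda>i. v i) (K n)) UNIV"
    by (rule site_uniforms.indep_vars_restrict) (auto simp: disjoint_family_on_def K_def)
  then have "site_uniforms.indep_vars (\<lambda>n. ?N n) r UNIV"
    by (simp add: r_def[abs_def])
  then have indep: "site_uniforms.indep_sets A UNIV"
    unfolding site_uniforms.indep_vars_def2 by (simp add: A_eq)
  have "{v. ?P (arr \<omega> v)} \<in> sigma_sets UNIV (\<Union> (A ` {n..}))" for n
  proof -
    define M where "M = sigma UNIV (\<Union> (A ` {n..}))"
    \<comment> \<open>All arrows at sites left of \<open>n\<close> are made left arrows. The result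
      is measurable for the groups from \<open>n\<close> on, and by \<open>good_cong\<close>
      goodness of sites \<open>\<ge> n\<close> is unchanged.\<close>
    define b where "b v z c \<longleftrightarrow> int n \<le> z \<and> arr \<omega> v z c" for v z c
    have sets_M: "sets M = sigma_sets UNIV (\<Union> (A ` {n..}))" and space_M: "space M = UNIV"
      by (auto simp: M_def)
    have "Measurable.pred M (\<lambda>v. b v z c)" for z c
    proof (cases "int n \<le> z")
      case True
      then have z: "(z, c) \<in> K (nat z)" "nat z \<ge> n" by (auto simp: K_def)
      have "{w \<in> space (?N (nat z)). w (z, c) < \<omega> (z, c)} \<in> sets (?N (nat z))"
        using z(1) by measurable
      moreover have "{v. b v z c} = r (nat z) -` {w \<in> space (?N (nat z)). w (z, c) < \<omega> (z, c)}"
        using True z(1) by (auto simp: b_def arr_def r_def space_PiM)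
      ultimately have "{v. b v z c} \<in> A (nat z)" unfolding A_eq by blast
      then have "{v. b v z c} \<in> sets M"
        using z(2) by (auto simp: sets_M intro!: sigma_sets.Basic)
      then show ?thesis by (simp add: pred_def space_M)
    qed (simp add: b_def)
    then have "Measurable.pred M (\<lambda>v. ?P (b v))"
      by (intro pred_arrow_event[of ?P] arrow_event_All arrow_event_Bex_good)
    moreover have "?P (b v) \<longleftrightarrow> ?P (arr \<omega> v)" for v
    proof -
      have eq: "good (b v) x = good (arr \<omega> v) x" if "x \<ge> int n" for x
        using that by (intro good_cong) (auto simp: b_def)
      \<comment> \<open>The rays shrink as \<open>m\<close> grows, so large \<open>m\<close> decide
        the event.\<close>
      have "?P a \<longleftrightarrow> (\<forall>m\<ge>int n. \<exists>x\<in>{m..}. good a x)" for a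
        by (meson atLeast_iff linorder_le_cases order_trans)
      then show ?thesis using eq by auto
    qed
    ultimately show ?thesis by (simp add: pred_def space_M sets_M)
  qed
  then have "{v. ?P (arr \<omega> v)} \<in> site_uniforms.tail_events A"
    by (simp add: site_uniforms.tail_events_def)
  moreover have "sigma_algebra (space site_uniforms) (A n)" for n
    using sets.sigma_algebra_axioms[of "vimage_algebra UNIV (r n) (?N n)"] by (simp add: A_def)
  ultimately show ?thesis
    using site_uniforms.kolmogorov_0_1_law[OF _ indep] by (auto simp: env_prob_def)
qed

lemma indep_coordinates:
  fixes J :: "(int \<times> nat) set"
  shows "site_uniforms.indep_var (PiM J (\<lambda>_. uniform01)) (\<lambda>v. restrict v J)
    (PiM (- J) (\<lambda>_. uniform01)) (\<lambda>v. restrict v (- J))"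
  using site_uniforms.indep_var_restrict[OF indep_vars_coordinates, of J "- J"] by simp

text \<open>Turning the first \<open>k\<close> arrows at the origin to the right costs a positive factor.\<close>

lemma env_prob_good_pos:
  assumes "\<And>c. c \<ge> 1 \<Longrightarrow> 0 < \<omega> (0, c) \<and> \<omega> (0, c) \<le> 1" and "env_prob \<omega> (transient 0) > 0"
  shows "env_prob \<omega> (\<lambda>a. good a 0) > 0"
proof (rule ccontr)
  assume "\<not> ?thesis"
  then have zero: "env_prob \<omega> (\<lambda>a. good a 0) = 0"
    using env_prob_bounds[of \<omega> "\<lambda>a. good a 0"] by simp
  let ?E = "\<lambda>k. {v. good (force (arr \<omega> v) 0 k) 0}"
  have force: "Measurable.pred M (\<lambda>w. force (a w) x k z c)"
    if "Measurable.pred M (\<lambda>w. a w z c)" for M :: "'m measure" and a x k z c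
    using that unfolding force_def by measurable
  have E_null: "?E k \<in> null_sets site_uniforms" for k
  proof -
    define J where "J = Pair (0::int) ` {1..k}"
    let ?A = "{w \<in> space (PiM J (\<lambda>_. uniform01)). \<forall>i\<in>J. w i < \<omega> i}"
    \<comment> \<open>These are the forced arrows written in terms of the uniforms outside
      \<open>J\<close> alone, which makes \<open>?E k\<close> independent of the uniforms in
      \<open>J\<close>.\<close>
    let ?b = "\<lambda>w z c. (z, c) \<in> J \<or> w (z, c) < \<omega> (z, c)"
    let ?B = "{w \<in> space (PiM (- J) (\<lambda>_. uniform01)). good (?b w) 0}"
    have [simp]: "finite J" by (simp add: J_def)
    have A: "?A \<in> sets (PiM J (\<lambda>_. uniform01))" by measurable
    have "Measurable.pred (PiM (- J) (\<lambda>_. uniform01)) (\<lambda>w. ?b w z c)" for z c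
    proof (cases "(z, c) \<in> J")
      case False
      then have [measurable]: "(\<lambda>w. w (z, c)) \<in> measurable (PiM (- J) (\<lambda>_. uniform01)) uniform01"
        by (intro measurable_component_singleton) simp
      show ?thesis by measurable
    qed simp
    then have "Measurable.pred (PiM (- J) (\<lambda>_. uniform01)) (\<lambda>w. good (?b w) 0)"
      by (rule pred_arrow_event[OF arrow_event_good])
    then have B: "?B \<in> sets (PiM (- J) (\<lambda>_. uniform01))" by simp
    have E: "?E k = (\<lambda>v. restrict v (- J)) -` ?B"
    proof -
      have "force (arr \<omega> v) 0 k = ?b (restrict v (- J))" for v
        by (auto simp: fun_eq_iff force_def arr_def J_def)
      then show ?thesis by (auto simp: space_PiM)
    qed
    have F: "{v. \<forall>i\<in>J. v i < \<omega> i} = (\<lambda>v. restrict v J) -` ?A"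
      by (auto simp: space_PiM)
    have "measure site_uniforms ({v. \<forall>i\<in>J. v i < \<omega> i} \<inter> ?E k) =
        measure site_uniforms {v. \<forall>i\<in>J. v i < \<omega> i} * measure site_uniforms (?E k)"
      using site_uniforms.indep_varD[OF indep_coordinates A B] unfolding E F
      by (simp add: vimage_def Int_def)
    \<comment> \<open>If the arrows in \<open>J\<close> point right by themselves, forcing changes
      nothing, so the intersection lies in the null event that 0 is good. As the first factor of the
      product is positive, \<open>?E k\<close> must be null.\<close>
    moreover have "measure site_uniforms ({v. \<forall>i\<in>J. v i < \<omega> i} \<inter> ?E k) = 0"
    proof -
      have "good (arr \<omega> v) 0" if "\<forall>i\<in>J. v i < \<omega> i" "v \<in> ?E k" for v
      proof -
        have "force (arr \<omega> v) 0 k = arr \<omega> v"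
          using that(1) by (auto simp: fun_eq_iff force_def arr_def J_def)
        then show ?thesis using that(2) by simp
      qed
      then have "measure site_uniforms ({v. \<forall>i\<in>J. v i < \<omega> i} \<inter> ?E k) \<le> env_prob \<omega> (\<lambda>a. good a 0)"
        unfolding env_prob_def
        by (intro site_uniforms.finite_measure_mono sets_arrow_event arrow_event_good) auto
      then show ?thesis using zero by (simp add: measure_le_0_iff)
    qed
    moreover have "measure site_uniforms {v. \<forall>i\<in>J. v i < \<omega> i} > 0"
    proof -
      have "emeasure site_uniforms {v. \<forall>i\<in>J. v i < \<omega> i} = (\<Prod>i\<in>J. emeasure uniform01 {..<\<omega> i})"
        using uniform01_product.emeasure_PiM_Collect[of J UNIV "\<lambda>i. {..<\<omega> i}"]
        by (simp add: site_uniforms_def space_PiM)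
      also have "\<dots> = ennreal (\<Prod>i\<in>J. measure uniform01 {..<\<omega> i})"
        by (simp add: uniform01.emeasure_eq_measure prod_ennreal)
      finally have "measure site_uniforms {v. \<forall>i\<in>J. v i < \<omega> i} =
          (\<Prod>i\<in>J. measure uniform01 {..<\<omega> i})"
        by (simp add: measure_def prod_nonneg)
      also have "\<dots> > 0"
        using assms(1) by (intro prod_pos) (auto simp: J_def measure_uniform01_lessThan less_imp_le)
      finally show ?thesis .
    qed
    ultimately have "measure site_uniforms (?E k) = 0" by simp
    moreover have "?E k \<in> sets site_uniforms"
    proof -
      have "Measurable.pred site_uniforms (\<lambda>v. good (force (arr \<omega> v) 0 k) 0)"
        by (intro pred_arrow_event[OF arrow_event_good] force) measurable
      then show ?thesis by (simp add: pred_def)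
    qed
    ultimately show ?thesis
      by (simp add: null_sets_def site_uniforms.emeasure_eq_measure)
  qed
  have "{v. transient 0 (arr \<omega> v)} \<subseteq> (\<Union>k. ?E k)"
    using transient_imp_good_force[OF is_walk_walk] by (fastforce simp: transient_def)
  moreover have "(\<Union>k. ?E k) \<in> null_sets site_uniforms"
    using E_null by (intro null_sets_UN)
  ultimately have "{v. transient 0 (arr \<omega> v)} \<in> null_sets site_uniforms"
    using sets_arrow_event[OF arrow_event_transient] by (rule null_sets_subset[rotated 2])
  then show False using assms(2) by (simp add: env_prob_def measure_def null_setsD1)
qed

section \<open>The zero-one law\<close>

lemma shift_in_space: "\<omega> \<in> space Omega \<Longrightarrow> shift \<omega> \<in> space Omega"
  by (auto simp: Omega_def space_PiM space_restrict_space shift_def cookie_index_def PiE_def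
      extensional_def Pi_def)

lemma measurable_OmegaI:
  assumes "\<And>i. (\<lambda>w. f w i) \<in> borel_measurable M" "\<And>w. w \<in> space M \<Longrightarrow> f w \<in> space Omega"
  shows "f \<in> measurable M Omega"
  unfolding Omega_def
proof (rule measurable_PiM_single')
  have in_PiE: "f w \<in> (\<Pi>\<^sub>E i\<in>cookie_index. {0..1})" if "w \<in> space M" for w
    using assms(2)[OF that] by (simp add: Omega_def space_PiM space_restrict_space)
  then show "f \<in> space M \<rightarrow> (\<Pi>\<^sub>E i\<in>cookie_index. space (restrict_space borel {0..1}))"
    by (auto simp: space_restrict_space)
  show "(\<lambda>w. f w i) \<in> M \<rightarrow>\<^sub>M restrict_space borel {0..1}" if "i \<in> cookie_index" for i
  proof (rule measurable_restrict_space2)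
    show "(\<lambda>w. f w i) \<in> space M \<rightarrow> {0..1}" using in_PiE that by (auto dest: PiE_mem)
  qed (rule assms(1))
qed

lemma measurable_shift: "shift \<in> measurable Omega Omega"
  by (rule measurable_OmegaI, simp add: shift_def split_beta) (rule shift_in_space)

lemma zero_one_right:
  assumes "prob_space \<mu>" and sets: "sets \<mu> = sets Omega" and "stationary \<mu>" "ergodic \<mu>" "elliptic \<mu>"
  shows "(\<integral>\<omega>. env_prob \<omega> (transient 0) \<partial>\<mu>) \<in> {0, 1}"
proof -
  interpret prob_space \<mu> by fact
  have space: "space \<mu> = space Omega" using sets by (rule sets_eq_imp_space_eq)
  note [measurable_cong] = sets
  have meas: "(\<lambda>\<omega>. env_prob \<omega> P) \<in> borel_measurable \<mu>" if "arrow_event P" for P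
    using borel_measurable_env_prob[OF that] measurable_cong_sets[OF sets refl] by blast
  have int: "integrable \<mu> (\<lambda>\<omega>. env_prob \<omega> P)" if "arrow_event P" for P
    using env_prob_bounds by (intro integrable_const_bound[of _ 1] meas that) auto
  have shift_meas: "shift \<in> measurable \<mu> \<mu>"
    using measurable_shift measurable_cong_sets[OF sets sets] by blast
  have distr: "distr \<mu> \<mu> shift = \<mu>"
    using assms(3) by (intro measure_eqI) (auto simp: emeasure_distr shift_meas stationary_def sets space)
  have shift_1: "(\<integral>\<omega>. env_prob \<omega> (\<lambda>a. P (\<lambda>z. a (z + 1))) \<partial>\<mu>) = (\<integral>\<omega>. env_prob \<omega> P \<partial>\<mu>)"
    if "arrow_event P" for P
  proof -
    have "(\<integral>\<omega>. env_prob \<omega> P \<partial>\<mu>) = (\<integral>\<omega>. env_prob \<omega> P \<partial>distr \<mu> \<mu> shift)" by (simp add: distr)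
    also have "\<dots> = (\<integral>\<omega>. env_prob (shift \<omega>) P \<partial>\<mu>)"
      using shift_meas meas[OF that] by (rule integral_distr)
    finally show ?thesis by (simp add: env_prob_shift[OF that])
  qed
  have good_int: "(\<integral>\<omega>. env_prob \<omega> (\<lambda>a. good a (int n)) \<partial>\<mu>) = (\<integral>\<omega>. env_prob \<omega> (\<lambda>a. good a 0) \<partial>\<mu>)" for n
  proof (induction n)
    case (Suc n)
    then show ?case
      using shift_1[OF arrow_event_good, of "int n"] by (simp add: good_shift add.commute)
  qed simp
  have transient_shift: "transient x (\<lambda>z. a (z + 1)) = transient (x + 1) a" for x a
  proof -
    have "walk (\<lambda>_. a) (x + 1) = (\<lambda>n. walk (\<lambda>_ z. a (z + 1)) x n + 1)"
      by (simp add: walk_shift fun_eq_iff)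
    moreover have "(\<forall>b::int. \<exists>N. \<forall>n\<ge>N. b \<le> Y n + 1) \<longleftrightarrow> (\<forall>b. \<exists>N. \<forall>n\<ge>N. b \<le> Y n)" for Y :: "nat \<Rightarrow> int"
      by (metis add_le_cancel_right diff_add_cancel)
    ultimately show ?thesis by (simp add: transient_def filterlim_at_top_int_iff)
  qed
  have transient_int: "(\<integral>\<omega>. env_prob \<omega> (transient (int n)) \<partial>\<mu>) = (\<integral>\<omega>. env_prob \<omega> (transient 0) \<partial>\<mu>)" for n
  proof (induction n)
    case (Suc n)
    then show ?case
      using shift_1[OF arrow_event_transient, of "int n"] by (simp add: transient_shift add.commute)
  qed simp
  let ?G = "\<lambda>a. \<forall>m. \<exists>x\<in>{m::int..}. good a x"
  define p where "p = (\<integral>\<omega>. env_prob \<omega> (\<lambda>a. good a 0) \<partial>\<mu>)"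
  have G_event: "arrow_event ?G" by (intro arrow_event_All arrow_event_Bex_good)
  \<comment> \<open>The events \<open>?H n\<close> decrease to \<open>?G\<close>, and each contains
    the event that \<open>n\<close> is good, whose annealed probability is \<open>p\<close> by
    stationarity.\<close>
  have G_ge: "p \<le> (\<integral>\<omega>. env_prob \<omega> ?G \<partial>\<mu>)"
  proof -
    let ?H = "\<lambda>n a. \<exists>x\<in>{int n..}. good a x"
    have lim: "(\<lambda>n. env_prob \<omega> (?H n)) \<longlonglongrightarrow> env_prob \<omega> ?G" for \<omega>
    proof -
      have "(\<lambda>n. measure site_uniforms {v. ?H n (arr \<omega> v)}) \<longlonglongrightarrow>
          measure site_uniforms (\<Inter>n. {v. ?H n (arr \<omega> v)})"
        by (intro site_uniforms.finite_Lim_measure_decseq)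
           (auto intro!: sets_arrow_event arrow_event_Bex_good simp: decseq_def)
      moreover have "?G a \<longleftrightarrow> (\<forall>n. ?H n a)" for a
      proof
        assume H: "\<forall>n. ?H n a"
        show "?G a"
        proof
          fix m
          \<comment> \<open>This includes negative \<open>m\<close>, where \<open>nat m\<close> is
            0.\<close>
          have "m \<le> int (nat m)" by simp
          then show "\<exists>x\<in>{m..}. good a x" using spec[OF H, of "nat m"] by force
        qed
      qed blast
      ultimately show ?thesis by (simp add: env_prob_def Collect_all_eq del: atLeast_iff)
    qed
    have "(\<lambda>n. \<integral>\<omega>. env_prob \<omega> (?H n) \<partial>\<mu>) \<longlonglongrightarrow> (\<integral>\<omega>. env_prob \<omega> ?G \<partial>\<mu>)"
      using lim env_prob_bounds
      by (intro integral_dominated_convergence[where w="\<lambda>_. 1"] meas G_event arrow_event_Bex_good) auto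
    moreover have "p \<le> (\<integral>\<omega>. env_prob \<omega> (?H n) \<partial>\<mu>)" for n
      unfolding p_def good_int[of n, symmetric]
      by (intro integral_mono int env_prob_mono arrow_event_good arrow_event_Bex_good) auto
    ultimately show ?thesis by (intro LIMSEQ_le_const) auto
  qed
  show ?thesis
  proof (cases "(\<integral>\<omega>. env_prob \<omega> (transient 0) \<partial>\<mu>) = 0")
    case False
    \<comment> \<open>If \<open>p\<close> were 0, almost every environment would give 0 quenched
      probability of being good, and by \<open>env_prob_good_pos\<close> and ellipticity also
      quenched transience probability 0.\<close>
    have "p > 0"
    proof (rule ccontr)
      assume "\<not> p > 0"
      moreover have "p \<ge> 0" unfolding p_def using env_prob_bounds by (intro integral_nonneg_AE) auto
      ultimately have "p = 0" by simp
      then have "AE \<omega> in \<mu>. env_prob \<omega> (\<lambda>a. good a 0) = 0"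
        using integral_nonneg_eq_0_iff_AE[OF int[OF arrow_event_good]] env_prob_bounds
        by (auto simp: p_def)
      moreover have "AE \<omega> in \<mu>. \<omega> \<in> {\<omega>\<in>space Omega. \<forall>i\<in>cookie_index. 0 < \<omega> i \<and> \<omega> i < 1}"
        using assms(5) by (intro AE_prob_1) (simp add: elliptic_def)
      ultimately have "AE \<omega> in \<mu>. env_prob \<omega> (transient 0) = 0"
      proof eventually_elim
        case (elim \<omega>)
        then have "0 < \<omega> (0, c) \<and> \<omega> (0, c) \<le> 1" if "c \<ge> 1" for c
          using that by (auto simp: cookie_index_def less_imp_le)
        with elim show ?case
          using env_prob_good_pos[of \<omega>] env_prob_bounds(1)[of \<omega> "transient 0"] by fastforce
      qed
      then have "(\<integral>\<omega>. env_prob \<omega> (transient 0) \<partial>\<mu>) = 0" by (intro integral_eq_zero_AE)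
      with False show False by simp
    qed
    \<comment> \<open>Quenched probabilities of \<open>?G\<close> are 0 or 1, so a null set
      \<open>S\<close> would make the annealed one 0, against \<open>G_ge\<close> and
      \<open>p > 0\<close>.\<close>
    define S where "S = {\<omega> \<in> space Omega. env_prob \<omega> ?G = 1}"
    have S_sets: "S \<in> sets Omega"
      using borel_measurable_env_prob[OF G_event] unfolding S_def by measurable
    have "shift -` S \<inter> space Omega = S"
    proof -
      \<comment> \<open>\<open>ergodic\<close> asks for exact invariance of \<open>S\<close>; it
        holds because moving all good sites by one merely reindexes \<open>m\<close>.\<close>
      have "?G (\<lambda>z. a (z + 1)) = ?G a" for a
      proof -
        have "(\<exists>x\<in>{m..}. good (\<lambda>z. a (z + 1)) x) \<longleftrightarrow> (\<exists>x\<in>{m + 1..}. good a x)" for m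
          unfolding good_shift
          by (metis add_le_cancel_right atLeast_iff diff_add_cancel)
        then show ?thesis by (metis diff_add_cancel)
      qed
      then have "env_prob (shift \<omega>) ?G = env_prob \<omega> ?G" for \<omega>
        by (subst env_prob_shift[OF G_event]) simp
      then show ?thesis using shift_in_space by (auto simp: S_def)
    qed
    then have "prob S = 0 \<or> prob S = 1"
      using assms(4) S_sets by (auto simp: ergodic_def)
    moreover have "prob S \<noteq> 0"
    proof
      assume "prob S = 0"
      then have "AE \<omega> in \<mu>. \<omega> \<notin> S"
        using S_sets by (intro AE_not_in) (auto simp: null_sets_def sets emeasure_eq_measure)
      moreover have "AE \<omega> in \<mu>. \<omega> \<in> space Omega" by (rule AE_I2) (simp add: space)
      ultimately have "AE \<omega> in \<mu>. env_prob \<omega> ?G = 0"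
      proof eventually_elim
        case (elim \<omega>)
        then show ?case using env_prob_good_io_zero_one[of \<omega>] by (auto simp: S_def)
      qed
      then have "(\<integral>\<omega>. env_prob \<omega> ?G \<partial>\<mu>) = 0" by (intro integral_eq_zero_AE)
      with G_ge \<open>p > 0\<close> show False by simp
    qed
    ultimately have AE_G: "AE \<omega> in \<mu>. env_prob \<omega> ?G = 1"
      using AE_prob_1[of S] by (auto simp: S_def)
    let ?R = "\<lambda>n a. \<exists>x\<in>{0..int n}. good a x"
    have "AE \<omega> in \<mu>. (\<lambda>n. env_prob \<omega> (?R n)) \<longlonglongrightarrow> 1"
      using AE_G
    proof eventually_elim
      case (elim \<omega>)
      let ?H = "\<lambda>a. \<exists>x\<in>{0::int..}. good a x"
      have "(\<lambda>n. measure site_uniforms {v. ?R n (arr \<omega> v)}) \<longlonglongrightarrow>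
          measure site_uniforms (\<Union>n. {v. ?R n (arr \<omega> v)})"
        by (intro site_uniforms.finite_Lim_measure_incseq)
           (force intro!: sets_arrow_event arrow_event_Bex_good simp: incseq_def)+
      also have "(\<Union>n. {v. ?R n (arr \<omega> v)}) = {v. ?H (arr \<omega> v)}"
        by (auto simp: Bex_def) (metis nat_0_le order_refl)
      finally have "(\<lambda>n. env_prob \<omega> (?R n)) \<longlonglongrightarrow> env_prob \<omega> ?H" by (simp add: env_prob_def)
      moreover have "env_prob \<omega> ?G \<le> env_prob \<omega> ?H"
        by (intro env_prob_mono arrow_event_Bex_good) blast
      then have "env_prob \<omega> ?H = 1" using elim env_prob_bounds(2)[of \<omega> ?H] by simp
      ultimately show ?case by simp
    qed
    then have "(\<lambda>n. \<integral>\<omega>. env_prob \<omega> (?R n) \<partial>\<mu>) \<longlonglongrightarrow> (\<integral>\<omega>. 1 \<partial>\<mu>)"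
      using env_prob_bounds
      by (intro integral_dominated_convergence[where w="\<lambda>_. 1"] meas arrow_event_Bex_good) auto
    moreover have "(\<integral>\<omega>. env_prob \<omega> (?R n) \<partial>\<mu>) \<le> (\<integral>\<omega>. env_prob \<omega> (transient 0) \<partial>\<mu>)" for n
    proof -
      \<comment> \<open>A good site in \<open>{0..int n}\<close> lies to the left of or at
        \<open>n\<close>, so least action makes the walk from \<open>n\<close> transient;
        \<open>transient_int\<close> carries this back to 0.\<close>
      have "transient (int n) a" if "?R n a" for a
        using that good_imp_transient(1)[OF is_walk_walk] by (auto simp: transient_def)
      then show ?thesis
        unfolding transient_int[of n, symmetric]
        by (intro integral_mono int env_prob_mono arrow_event_transient arrow_event_Bex_good)
    qed
    ultimately have "1 \<le> (\<integral>\<omega>. env_prob \<omega> (transient 0) \<partial>\<mu>)"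
      by (intro LIMSEQ_le_const2[of _ 1]) (auto simp: prob_space)
    moreover have "(\<integral>\<omega>. env_prob \<omega> (transient 0) \<partial>\<mu>) \<le> 1"
      using integral_mono[OF int[OF arrow_event_transient], of "\<lambda>_. 1" 0] env_prob_bounds
      by (simp add: prob_space)
    ultimately show ?thesis by simp
  qed simp
qed

section \<open>Reflection and the left direction\<close>

lemma reflect_in_space: "\<omega> \<in> space Omega \<Longrightarrow> reflect \<omega> \<in> space Omega"
  by (auto simp: Omega_def space_PiM space_restrict_space reflect_def cookie_index_def PiE_def
      extensional_def Pi_def)

lemma measurable_reflect: "reflect \<in> measurable Omega Omega"
  by (rule measurable_OmegaI, simp add: reflect_def split_beta) (rule reflect_in_space)

definition unshift :: "((int \<times> nat) \<Rightarrow> real) \<Rightarrow> ((int \<times> nat) \<Rightarrow> real)" where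
  "unshift \<omega> = (\<lambda>(x, n). \<omega> (x - 1, n))"

lemma unshift_shift [simp]: "unshift (shift \<omega>) = \<omega>"
  by (auto simp: shift_def unshift_def)

text \<open>Reflection conjugates the shift to its inverse, so properties of \<open>\<mu>\<close>
  under \<open>shift\<close> transfer to the reflected measure by undoing one shift.\<close>

lemma shift_reflect: "shift (reflect \<omega>) = reflect (unshift \<omega>)"
  by (auto simp: shift_def unshift_def reflect_def fun_eq_iff algebra_simps)

lemma stationary_ergodic_reflect:
  assumes "prob_space \<mu>" and sets: "sets \<mu> = sets Omega" and "stationary \<mu>" "ergodic \<mu>" "elliptic \<mu>"
  defines "\<nu> \<equiv> distr \<mu> Omega reflect"
  shows "prob_space \<nu>" "sets \<nu> = sets Omega" "stationary \<nu>" "ergodic \<nu>" "elliptic \<nu>"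
proof -
  interpret prob_space \<mu> by fact
  have space: "space \<mu> = space Omega" using sets by (rule sets_eq_imp_space_eq)
  have meas: "reflect \<in> measurable \<mu> Omega"
    using measurable_reflect measurable_cong_sets[OF sets refl] by blast
  show "prob_space \<nu>" unfolding \<nu>_def using meas by (rule prob_space_distr)
  show "sets \<nu> = sets Omega" by (simp add: \<nu>_def)
  have \<nu>: "emeasure \<nu> A = emeasure \<mu> (reflect -` A \<inter> space Omega)" if "A \<in> sets Omega" for A
    using emeasure_distr[OF meas that] by (simp add: \<nu>_def space)
  have \<nu>': "measure \<nu> A = prob (reflect -` A \<inter> space Omega)" if "A \<in> sets Omega" for A
    using \<nu>[OF that] by (simp add: measure_def)
  have reflect_sets: "reflect -` A \<inter> space Omega \<in> sets Omega" if "A \<in> sets Omega" for A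
    using measurable_reflect that by (rule measurable_sets)
  show "stationary \<nu>"
    unfolding stationary_def
  proof
    fix A assume A: "A \<in> sets Omega"
    let ?B = "reflect -` A \<inter> space Omega" and ?C = "shift -` A \<inter> space Omega"
    have C: "?C \<in> sets Omega" using measurable_shift A by (rule measurable_sets)
    have D: "reflect -` ?C \<inter> space Omega \<in> sets Omega" using C by (rule reflect_sets)
    \<comment> \<open>By \<open>shift_reflect\<close> the preimage under \<open>?C\<close> involves
      \<open>unshift\<close>; one further shift cancels it, and stationarity of \<open>\<mu>\<close>
      makes that shift free.\<close>
    have "shift -` (reflect -` ?C \<inter> space Omega) \<inter> space Omega = ?B"
      using shift_in_space reflect_in_space by (auto simp: shift_reflect)
    then have "emeasure \<mu> (reflect -` ?C \<inter> space Omega) = emeasure \<mu> ?B"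
      using assms(3) D by (metis stationary_def)
    then show "emeasure \<nu> ?C = emeasure \<nu> A" using A C by (simp add: \<nu>)
  qed
  show "ergodic \<nu>"
    unfolding ergodic_def
  proof (intro ballI impI)
    fix A assume A: "A \<in> sets Omega" and inv: "shift -` A \<inter> space Omega = A"
    let ?B = "reflect -` A \<inter> space Omega"
    have iff: "shift \<omega> \<in> A \<longleftrightarrow> \<omega> \<in> A" if "\<omega> \<in> space Omega" for \<omega> using inv that by blast
    \<comment> \<open>Shifting \<open>reflect (shift \<omega>)\<close> gives
      \<open>reflect \<omega>\<close>, so invariance of \<open>A\<close> is used at that
      point.\<close>
    have "reflect (shift \<omega>) \<in> A \<longleftrightarrow> reflect \<omega> \<in> A" if "\<omega> \<in> space Omega" for \<omega>
      using iff[of "reflect (shift \<omega>)"] that shift_in_space reflect_in_space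
      by (simp add: shift_reflect)
    then have "shift -` ?B \<inter> space Omega = ?B" using shift_in_space by auto
    then have "prob ?B = 0 \<or> prob ?B = 1"
      using assms(4) reflect_sets[OF A] by (auto simp: ergodic_def)
    then show "measure \<nu> A = 0 \<or> measure \<nu> A = 1" by (simp add: \<nu>' A)
  qed
  show "elliptic \<nu>"
  proof -
    let ?E = "{\<omega>\<in>space Omega. \<forall>i\<in>cookie_index. 0 < \<omega> i \<and> \<omega> i < 1}"
    have "countable cookie_index" by simp
    then have "?E \<in> sets Omega" by measurable
    moreover have "reflect -` ?E \<inter> space Omega = ?E"
    proof -
      \<comment> \<open>The open unit interval is symmetric about 1/2, and negation permutes the
        sites.\<close>
      have "(\<forall>i\<in>cookie_index. 0 < reflect \<omega> i \<and> reflect \<omega> i < 1) \<longleftrightarrow>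
          (\<forall>i\<in>cookie_index. 0 < \<omega> i \<and> \<omega> i < 1)" for \<omega>
        by (auto simp: cookie_index_def reflect_def) (metis minus_minus)+
      then show ?thesis using reflect_in_space by auto
    qed
    ultimately show ?thesis using assms(5) by (simp add: elliptic_def \<nu>')
  qed
qed

theorem theorem1p1:
  fixes \<mu> :: "((int \<times> nat) \<Rightarrow> real) measure"
  assumes "prob_space \<mu>"
    and "sets \<mu> = sets Omega"
    and "stationary \<mu>"
    and "ergodic \<mu>"
    and "elliptic \<mu>"
  shows "annealed_right \<mu> 0 \<in> {0, 1} \<and> annealed_left \<mu> 0 \<in> {0, 1}"
proof
  show "annealed_right \<mu> 0 \<in> {0, 1}"
    using zero_one_right[OF assms] by (simp add: annealed_right_def quenched_right_eq)
  have space: "space \<mu> = space Omega" using assms(2) by (rule sets_eq_imp_space_eq)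
  have meas: "reflect \<in> measurable \<mu> Omega"
    using measurable_reflect measurable_cong_sets[OF assms(2) refl] by blast
  have "annealed_left \<mu> 0 = (\<integral>\<omega>. env_prob (reflect \<omega>) (transient 0) \<partial>\<mu>)"
    unfolding annealed_left_def
    by (intro Bochner_Integration.integral_cong) (auto simp: quenched_left_eq space)
  also have "\<dots> = (\<integral>\<omega>. env_prob \<omega> (transient 0) \<partial>distr \<mu> Omega reflect)"
    using meas borel_measurable_env_prob[OF arrow_event_transient] by (rule integral_distr[symmetric])
  also have "\<dots> \<in> {0, 1}"
    by (intro zero_one_right stationary_ergodic_reflect assms)
  finally show "annealed_left \<mu> 0 \<in> {0, 1}" .
qed

end
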